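(* Let $(\mathcal{M},\otimes,I)$ be a monoidal category and let $\mathbb{S}:\mathcal{M}\to\mathbf{Cat}$ be the selection-relation functor, given on objects by $\mathbb{S}(X)=\mathcal{P}(\mathcal{M}(I,X)\times\mathcal{M}(X,I))$ (a poset under inclusion) and on morphisms $f:X\to Y$ by $\mathbb{S}(f)(\varepsilon)=\{(x\mathbin{;}f,k)\mid (x,f\mathbin{;}k)\in\varepsilon\}$. Then $\mathbb{S}$ admits a laxator $\boxtimes:\mathbb{S}(X)\times\mathbb{S}(Y)\to\mathbb{S}(X\otimes Y)$, i.e. the maps $\boxtimes$ are natural in $X,Y$ and are the binary structure maps of a lax monoidal functor $(\mathcal{M},\otimes,I)\to(\mathbf{Cat},\times,1)$, given by $$\varepsilon\boxtimes\delta=\{(x\otimes y,k)\mid (x,k_y)\in\varepsilon\ \text{and}\ (y,k_x)\in\delta\},$$ where $x:I\to X$, $y:I\to Y$, $k:X\otimes Y\to I$, and $$k_x: Y\cong I\otimes Y\xrightarrow{x\otimes Y}X\otimes Y\xrightarrow{k}I,\qquad k_y: X\cong X\otimes I\xrightarrow{X\otimes y}X\otimes Y\xrightarrow{k}I .$$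
   Context: Composition is written in diagrammatic order: $f\mathbin{;}g$ means first $f$, then $g$. $\mathcal{P}$ denotes the powerset. A poset is regarded as a category, so that monotone maps are functors. Elements of $\mathbb{S}(X)$ are called selection relations on $X$: a selection relation is a relation between states $x:I\to X$ and costates $k:X\to I$. For $x:I\to X$ and $y:I\to Y$, the state $x\otimes y:I\to X\otimes Y$ means the composite $I\cong I\otimes I\xrightarrow{x\otimes y}X\otimes Y$. The operation $\boxtimes$ is called the Nash product. *)

theory Defs
  imports Main
begin

section \<open>Categories and functors\<close>

text \<open>Composition is diagrammatic: \<open>f \<Zsemi> g\<close> is first \<open>f\<close>, then \<open>g\<close>.\<close>

record ('o, 'a) cat =
  Ob :: "'o set"
  Ar :: "'a set"
  src :: "'a \<Rightarrow> 'o"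
  tgt :: "'a \<Rightarrow> 'o"
  ident :: "'o \<Rightarrow> 'a"
  seq :: "'a \<Rightarrow> 'a \<Rightarrow> 'a" (infixl "\<Zsemi>\<index>" 65)

definition hom :: "('o, 'a, 'm) cat_scheme \<Rightarrow> 'o \<Rightarrow> 'o \<Rightarrow> 'a set" where
  "hom C X Y = {f \<in> Ar C. src C f = X \<and> tgt C f = Y}"

locale category =
  fixes C :: "('o, 'a, 'm) cat_scheme" (structure)
  assumes src_closed: "f \<in> Ar C \<Longrightarrow> src C f \<in> Ob C"
    and tgt_closed: "f \<in> Ar C \<Longrightarrow> tgt C f \<in> Ob C"
    and ident_closed: "X \<in> Ob C \<Longrightarrow> ident C X \<in> hom C X X"
    and seq_closed: "f \<in> hom C X Y \<Longrightarrow> g \<in> hom C Y Z \<Longrightarrow> f \<Zsemi> g \<in> hom C X Z"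
    and ident_seq: "f \<in> hom C X Y \<Longrightarrow> ident C X \<Zsemi> f = f"
    and seq_ident: "f \<in> hom C X Y \<Longrightarrow> f \<Zsemi> ident C Y = f"
    and seq_assoc: "f \<in> hom C W X \<Longrightarrow> g \<in> hom C X Y \<Longrightarrow> h \<in> hom C Y Z
      \<Longrightarrow> (f \<Zsemi> g) \<Zsemi> h = f \<Zsemi> (g \<Zsemi> h)"

definition inverses :: "('o, 'a, 'm) cat_scheme \<Rightarrow> 'a \<Rightarrow> 'a \<Rightarrow> bool" where
  "inverses C f g \<longleftrightarrow> f \<in> Ar C \<and> g \<in> hom C (tgt C f) (src C f)
     \<and> seq C f g = ident C (src C f) \<and> seq C g f = ident C (tgt C f)"

definition iso :: "('o, 'a, 'm) cat_scheme \<Rightarrow> 'a \<Rightarrow> bool" where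
  "iso C f \<longleftrightarrow> (\<exists>g. inverses C f g)"

definition inv_ar :: "('o, 'a, 'm) cat_scheme \<Rightarrow> 'a \<Rightarrow> 'a" where
  "inv_ar C f = (THE g. inverses C f g)"

record ('o1, 'a1, 'o2, 'a2) fctr =
  on_ob :: "'o1 \<Rightarrow> 'o2"
  on_ar :: "'a1 \<Rightarrow> 'a2"

definition functor_between ::
  "('o1, 'a1, 'm1) cat_scheme \<Rightarrow> ('o2, 'a2, 'm2) cat_scheme \<Rightarrow> ('o1, 'a1, 'o2, 'a2) fctr \<Rightarrow> bool" where
  "functor_between C D F \<longleftrightarrow> category C \<and> category D
     \<and> (\<forall>X \<in> Ob C. on_ob F X \<in> Ob D)
     \<and> (\<forall>f \<in> Ar C. on_ar F f \<in> hom D (on_ob F (src C f)) (on_ob F (tgt C f)))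
     \<and> (\<forall>X \<in> Ob C. on_ar F (ident C X) = ident D (on_ob F X))
     \<and> (\<forall>f \<in> Ar C. \<forall>g \<in> Ar C. tgt C f = src C g \<longrightarrow>
          on_ar F (seq C f g) = seq D (on_ar F f) (on_ar F g))"

text \<open>Functors are represented by total HOL functions whose values outside the source category are
  irrelevant, so equality of functors with source \<open>C\<close> is agreement on the objects and arrows of \<open>C\<close>.\<close>

definition functor_eq ::
  "('o1, 'a1, 'm) cat_scheme \<Rightarrow> ('o1, 'a1, 'o2, 'a2) fctr \<Rightarrow> ('o1, 'a1, 'o2, 'a2) fctr \<Rightarrow> bool" where
  "functor_eq C F G \<longleftrightarrow>
     (\<forall>X \<in> Ob C. on_ob F X = on_ob G X) \<and> (\<forall>f \<in> Ar C. on_ar F f = on_ar G f)"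

definition id_fctr :: "('o, 'a, 'o, 'a) fctr" where
  "id_fctr = \<lparr>on_ob = (\<lambda>X. X), on_ar = (\<lambda>f. f)\<rparr>"

definition seq_fctr ::
  "('o1, 'a1, 'o2, 'a2) fctr \<Rightarrow> ('o2, 'a2, 'o3, 'a3) fctr \<Rightarrow> ('o1, 'a1, 'o3, 'a3) fctr"
  (infixl ";;" 65) where
  "F ;; G = \<lparr>on_ob = (\<lambda>X. on_ob G (on_ob F X)), on_ar = (\<lambda>f. on_ar G (on_ar F f))\<rparr>"


section \<open>The cartesian monoidal structure of Cat\<close>

definition prod_cat ::
  "('o1, 'a1) cat \<Rightarrow> ('o2, 'a2) cat \<Rightarrow> ('o1 \<times> 'o2, 'a1 \<times> 'a2) cat" (infixr "\<times>\<^sub>C" 80) where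
  "C \<times>\<^sub>C D = \<lparr>Ob = Ob C \<times> Ob D, Ar = Ar C \<times> Ar D,
     src = map_prod (src C) (src D), tgt = map_prod (tgt C) (tgt D),
     ident = map_prod (ident C) (ident D),
     seq = (\<lambda>(f, f') (g, g'). (seq C f g, seq D f' g'))\<rparr>"

definition terminal_cat :: "(unit, unit) cat" where
  "terminal_cat = \<lparr>Ob = UNIV, Ar = UNIV, src = (\<lambda>_. ()), tgt = (\<lambda>_. ()),
     ident = (\<lambda>_. ()), seq = (\<lambda>_ _. ())\<rparr>"

definition prod_fctr ::
  "('o1, 'a1, 'o2, 'a2) fctr \<Rightarrow> ('p1, 'b1, 'p2, 'b2) fctr
     \<Rightarrow> ('o1 \<times> 'p1, 'a1 \<times> 'b1, 'o2 \<times> 'p2, 'a2 \<times> 'b2) fctr" (infixr "\<times>\<^sub>F" 80) where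
  "F \<times>\<^sub>F G = \<lparr>on_ob = map_prod (on_ob F) (on_ob G), on_ar = map_prod (on_ar F) (on_ar G)\<rparr>"

definition assoc_Cat ::
  "(('o1 \<times> 'o2) \<times> 'o3, ('a1 \<times> 'a2) \<times> 'a3, 'o1 \<times> 'o2 \<times> 'o3, 'a1 \<times> 'a2 \<times> 'a3) fctr" where
  "assoc_Cat = \<lparr>on_ob = (\<lambda>((X, Y), Z). (X, Y, Z)), on_ar = (\<lambda>((f, g), h). (f, g, h))\<rparr>"

definition lunit_Cat :: "(unit \<times> 'o, unit \<times> 'a, 'o, 'a) fctr" where
  "lunit_Cat = \<lparr>on_ob = snd, on_ar = snd\<rparr>"

definition runit_Cat :: "('o \<times> unit, 'a \<times> unit, 'o, 'a) fctr" where
  "runit_Cat = \<lparr>on_ob = fst, on_ar = fst\<rparr>"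


section \<open>Monoidal categories\<close>

record ('o, 'a) monoidal_cat = "('o, 'a) cat" +
  tensor_ob :: "'o \<Rightarrow> 'o \<Rightarrow> 'o" (infixr "\<otimes>\<^sub>o\<index>" 70)
  tensor_ar :: "'a \<Rightarrow> 'a \<Rightarrow> 'a" (infixr "\<otimes>\<index>" 70)
  unit_ob :: "'o" ("\<I>\<index>")
  assoc :: "'o \<Rightarrow> 'o \<Rightarrow> 'o \<Rightarrow> 'a"
  lunit :: "'o \<Rightarrow> 'a"
  runit :: "'o \<Rightarrow> 'a"

locale monoidal_category = category M
  for M :: "('o, 'a, 'm) monoidal_cat_scheme" (structure) +
  assumes unit_closed: "\<I> \<in> Ob M"
    and tensor_ob_closed: "X \<in> Ob M \<Longrightarrow> Y \<in> Ob M \<Longrightarrow> X \<otimes>\<^sub>o Y \<in> Ob M"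
    and tensor_ar_closed: "f \<in> hom M X X' \<Longrightarrow> g \<in> hom M Y Y'
      \<Longrightarrow> f \<otimes> g \<in> hom M (X \<otimes>\<^sub>o Y) (X' \<otimes>\<^sub>o Y')"
    and tensor_ident: "X \<in> Ob M \<Longrightarrow> Y \<in> Ob M
      \<Longrightarrow> ident M X \<otimes> ident M Y = ident M (X \<otimes>\<^sub>o Y)"
    and tensor_seq: "f \<in> hom M X X' \<Longrightarrow> f' \<in> hom M X' X'' \<Longrightarrow> g \<in> hom M Y Y' \<Longrightarrow> g' \<in> hom M Y' Y''
      \<Longrightarrow> (f \<Zsemi> f') \<otimes> (g \<Zsemi> g') = (f \<otimes> g) \<Zsemi> (f' \<otimes> g')"
    and assoc_closed: "X \<in> Ob M \<Longrightarrow> Y \<in> Ob M \<Longrightarrow> Z \<in> Ob M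
      \<Longrightarrow> assoc M X Y Z \<in> hom M ((X \<otimes>\<^sub>o Y) \<otimes>\<^sub>o Z) (X \<otimes>\<^sub>o (Y \<otimes>\<^sub>o Z))"
    and assoc_iso: "X \<in> Ob M \<Longrightarrow> Y \<in> Ob M \<Longrightarrow> Z \<in> Ob M \<Longrightarrow> iso M (assoc M X Y Z)"
    and assoc_natural: "f \<in> hom M X X' \<Longrightarrow> g \<in> hom M Y Y' \<Longrightarrow> h \<in> hom M Z Z'
      \<Longrightarrow> ((f \<otimes> g) \<otimes> h) \<Zsemi> assoc M X' Y' Z' = assoc M X Y Z \<Zsemi> (f \<otimes> (g \<otimes> h))"
    and lunit_closed: "X \<in> Ob M \<Longrightarrow> lunit M X \<in> hom M (\<I> \<otimes>\<^sub>o X) X"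
    and lunit_iso: "X \<in> Ob M \<Longrightarrow> iso M (lunit M X)"
    and lunit_natural: "f \<in> hom M X X' \<Longrightarrow> (ident M \<I> \<otimes> f) \<Zsemi> lunit M X' = lunit M X \<Zsemi> f"
    and runit_closed: "X \<in> Ob M \<Longrightarrow> runit M X \<in> hom M (X \<otimes>\<^sub>o \<I>) X"
    and runit_iso: "X \<in> Ob M \<Longrightarrow> iso M (runit M X)"
    and runit_natural: "f \<in> hom M X X' \<Longrightarrow> (f \<otimes> ident M \<I>) \<Zsemi> runit M X' = runit M X \<Zsemi> f"
    and triangle: "X \<in> Ob M \<Longrightarrow> Y \<in> Ob M
      \<Longrightarrow> assoc M X \<I> Y \<Zsemi> (ident M X \<otimes> lunit M Y) = runit M X \<otimes> ident M Y"
    and pentagon: "W \<in> Ob M \<Longrightarrow> X \<in> Ob M \<Longrightarrow> Y \<in> Ob M \<Longrightarrow> Z \<in> Ob M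
      \<Longrightarrow> (assoc M W X Y \<otimes> ident M Z) \<Zsemi> assoc M W (X \<otimes>\<^sub>o Y) Z \<Zsemi> (ident M W \<otimes> assoc M X Y Z)
        = assoc M (W \<otimes>\<^sub>o X) Y Z \<Zsemi> assoc M W X (Y \<otimes>\<^sub>o Z)"


section \<open>Lax monoidal functors into Cat\<close>

text \<open>A functor into the 1-category Cat, with action \<open>Fo\<close> on objects and \<open>Fa\<close> on arrows.\<close>

locale Cat_valued_functor = category C
  for C :: "('o, 'a, 'm) cat_scheme"
    and Fo :: "'o \<Rightarrow> ('p, 'b) cat"
    and Fa :: "'a \<Rightarrow> ('p, 'b, 'p, 'b) fctr" +
  assumes on_objects: "X \<in> Ob C \<Longrightarrow> category (Fo X)"
    and on_arrows: "f \<in> hom C X Y \<Longrightarrow> functor_between (Fo X) (Fo Y) (Fa f)"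
    and on_ident: "X \<in> Ob C \<Longrightarrow> functor_eq (Fo X) (Fa (ident C X)) id_fctr"
    and on_seq: "f \<in> hom C X Y \<Longrightarrow> g \<in> hom C Y Z
      \<Longrightarrow> functor_eq (Fo X) (Fa (seq C f g)) (Fa f ;; Fa g)"

text \<open>Cat itself is not a term of HOL: the products \<open>Fo X \<times>\<^sub>C Fo Y\<close> live at different types.
  Hence the usual definition of a lax monoidal functor, with laxator \<open>mu\<close> and unit map \<open>eta\<close>, is
  written out for the target (Cat, \<open>\<times>\<close>, 1).\<close>

locale lax_monoidal_functor_to_Cat =
  monoidal_category M + Cat_valued_functor M Fo Fa
  for M :: "('o, 'a, 'm) monoidal_cat_scheme" (structure)
    and Fo :: "'o \<Rightarrow> ('p, 'b) cat"
    and Fa :: "'a \<Rightarrow> ('p, 'b, 'p, 'b) fctr"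
    and mu :: "'o \<Rightarrow> 'o \<Rightarrow> ('p \<times> 'p, 'b \<times> 'b, 'p, 'b) fctr"
    and eta :: "(unit, unit, 'p, 'b) fctr" +
  assumes laxator_functor: "X \<in> Ob M \<Longrightarrow> Y \<in> Ob M
      \<Longrightarrow> functor_between (Fo X \<times>\<^sub>C Fo Y) (Fo (X \<otimes>\<^sub>o Y)) (mu X Y)"
    and unit_functor: "functor_between terminal_cat (Fo \<I>) eta"
    and laxator_natural: "f \<in> hom M X X' \<Longrightarrow> g \<in> hom M Y Y'
      \<Longrightarrow> functor_eq (Fo X \<times>\<^sub>C Fo Y) ((Fa f \<times>\<^sub>F Fa g) ;; mu X' Y') (mu X Y ;; Fa (f \<otimes> g))"
    and laxator_assoc: "X \<in> Ob M \<Longrightarrow> Y \<in> Ob M \<Longrightarrow> Z \<in> Ob M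
      \<Longrightarrow> functor_eq ((Fo X \<times>\<^sub>C Fo Y) \<times>\<^sub>C Fo Z)
            ((mu X Y \<times>\<^sub>F id_fctr) ;; mu (X \<otimes>\<^sub>o Y) Z ;; Fa (assoc M X Y Z))
            (assoc_Cat ;; (id_fctr \<times>\<^sub>F mu Y Z) ;; mu X (Y \<otimes>\<^sub>o Z))"
    and laxator_lunit: "X \<in> Ob M
      \<Longrightarrow> functor_eq (terminal_cat \<times>\<^sub>C Fo X)
            ((eta \<times>\<^sub>F id_fctr) ;; mu \<I> X ;; Fa (lunit M X)) lunit_Cat"
    and laxator_runit: "X \<in> Ob M
      \<Longrightarrow> functor_eq (Fo X \<times>\<^sub>C terminal_cat)
            ((id_fctr \<times>\<^sub>F eta) ;; mu X \<I> ;; Fa (runit M X)) runit_Cat"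


section \<open>Posets as categories\<close>

text \<open>The unique arrow \<open>p \<le> q\<close> is the pair \<open>(p, q)\<close>.\<close>

definition poset_cat :: "'p::order set \<Rightarrow> ('p, 'p \<times> 'p) cat" where
  "poset_cat P = \<lparr>Ob = P, Ar = {(p, q). p \<in> P \<and> q \<in> P \<and> p \<le> q}, src = fst, tgt = snd,
     ident = (\<lambda>p. (p, p)), seq = (\<lambda>f g. (fst f, snd g))\<rparr>"

definition mono_fctr :: "('p \<Rightarrow> 'q) \<Rightarrow> ('p, 'p \<times> 'p, 'q, 'q \<times> 'q) fctr" where
  "mono_fctr h = \<lparr>on_ob = h, on_ar = (\<lambda>(p, p'). (h p, h p'))\<rparr>"

text \<open>An arrow \<open>((p, p'), (q, q'))\<close> of a product of two poset categories stands for
  \<open>p \<le> p'\<close> and \<open>q \<le> q'\<close>.\<close>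

definition mono_fctr2 ::
  "('p \<Rightarrow> 'q \<Rightarrow> 'r) \<Rightarrow> ('p \<times> 'q, ('p \<times> 'p) \<times> ('q \<times> 'q), 'r, 'r \<times> 'r) fctr" where
  "mono_fctr2 h = \<lparr>on_ob = (\<lambda>(p, q). h p q),
     on_ar = (\<lambda>((p, p'), (q, q')). (h p q, h p' q'))\<rparr>"


section \<open>Selection relations and the Nash product\<close>

context
  fixes M :: "('o, 'a, 'm) monoidal_cat_scheme" (structure)
begin

definition sel_rels :: "'o \<Rightarrow> ('a \<times> 'a) set set" where
  "sel_rels X = Pow (hom M \<I> X \<times> hom M X \<I>)"

definition sel_map :: "'a \<Rightarrow> ('a \<times> 'a) set \<Rightarrow> ('a \<times> 'a) set" where
  "sel_map f \<epsilon> = {(x \<Zsemi> f, k) |x k.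
     x \<in> hom M \<I> (src M f) \<and> k \<in> hom M (tgt M f) \<I> \<and> (x, f \<Zsemi> k) \<in> \<epsilon>}"

definition sel_ob :: "'o \<Rightarrow> (('a \<times> 'a) set, ('a \<times> 'a) set \<times> ('a \<times> 'a) set) cat" where
  "sel_ob X = poset_cat (sel_rels X)"

definition sel_ar ::
  "'a \<Rightarrow> (('a \<times> 'a) set, ('a \<times> 'a) set \<times> ('a \<times> 'a) set,
          ('a \<times> 'a) set, ('a \<times> 'a) set \<times> ('a \<times> 'a) set) fctr" where
  "sel_ar f = mono_fctr (sel_map f)"

text \<open>The isomorphism from \<open>\<I>\<close> to \<open>\<I> \<otimes> \<I>\<close> is the inverse of the left unitor, which in any
  monoidal category is also the inverse of the right unitor.\<close>

definition tensor_state :: "'a \<Rightarrow> 'a \<Rightarrow> 'a" where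
  "tensor_state x y = inv_ar M (lunit M \<I>) \<Zsemi> (x \<otimes> y)"

text \<open>\<open>costate_right Y x k\<close> is \<open>k\<^sub>x : Y \<rightarrow> \<I>\<close> and \<open>costate_left X y k\<close> is \<open>k\<^sub>y : X \<rightarrow> \<I>\<close>,
  for states \<open>x\<close> of \<open>X\<close>, \<open>y\<close> of \<open>Y\<close> and a costate \<open>k\<close> of \<open>X \<otimes> Y\<close>.\<close>

definition costate_right :: "'o \<Rightarrow> 'a \<Rightarrow> 'a \<Rightarrow> 'a" where
  "costate_right Y x k = inv_ar M (lunit M Y) \<Zsemi> (x \<otimes> ident M Y) \<Zsemi> k"

definition costate_left :: "'o \<Rightarrow> 'a \<Rightarrow> 'a \<Rightarrow> 'a" where
  "costate_left X y k = inv_ar M (runit M X) \<Zsemi> (ident M X \<otimes> y) \<Zsemi> k"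

definition nash_product ::
  "'o \<Rightarrow> 'o \<Rightarrow> ('a \<times> 'a) set \<Rightarrow> ('a \<times> 'a) set \<Rightarrow> ('a \<times> 'a) set" where
  "nash_product X Y \<epsilon> \<delta> = {(tensor_state x y, k) |x y k.
     x \<in> hom M \<I> X \<and> y \<in> hom M \<I> Y \<and> k \<in> hom M (X \<otimes>\<^sub>o Y) \<I>
     \<and> (x, costate_left X y k) \<in> \<epsilon> \<and> (y, costate_right Y x k) \<in> \<delta>}"

definition nash_laxator ::
  "'o \<Rightarrow> 'o \<Rightarrow> (('a \<times> 'a) set \<times> ('a \<times> 'a) set,
     (('a \<times> 'a) set \<times> ('a \<times> 'a) set) \<times> (('a \<times> 'a) set \<times> ('a \<times> 'a) set),
     ('a \<times> 'a) set, ('a \<times> 'a) set \<times> ('a \<times> 'a) set) fctr" where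
  "nash_laxator X Y = mono_fctr2 (nash_product X Y)"

end

end

theory Submission
  imports Defs
begin

text \<open>
  Why \<open>\<boxtimes>\<close> is a laxator. A selection relation on \<open>X\<close> relates states of \<open>X\<close> to costates of \<open>X\<close>,
  and \<open>\<S>(f)\<close> pushes states forward and pulls costates back along \<open>f\<close>. An element of
  \<open>\<epsilon> \<boxtimes> \<delta>\<close> is a pair of strategies \<open>x\<close>, \<open>y\<close> with a payoff \<open>k\<close> on \<open>X \<otimes> Y\<close> such that \<open>x\<close> is selected
  against \<open>k\<close> with \<open>y\<close> plugged in, and \<open>y\<close> is selected against \<open>k\<close> with \<open>x\<close> plugged in. Each law of a lax
  monoidal functor becomes an equation between states together with equations between
  costates obtained by such partial evaluations of \<open>k\<close>:

  \<^item> naturality: \<open>((f \<otimes> g) \<Zsemi> k)\<^sub>y = f \<Zsemi> k\<^sub>y\<^sub>\<Zsemi>\<^sub>g\<close> and its mirror image, by bifunctoriality of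
    \<open>\<otimes>\<close> and naturality of the unitors (\<open>costate_left_natural\<close>, \<open>costate_right_natural\<close>);

  \<^item> associativity: both bracketings describe triples \<open>x\<close>, \<open>y\<close>, \<open>z\<close> each of which is selected against
    \<open>k\<close> with the two others plugged in. Plugging in two states does not depend on
    the order or the bracketing (\<open>costate_left_left\<close>, \<open>costate_right_left\<close>,
    \<open>costate_right_right\<close>), and neither does tensoring three states (\<open>tensor_state_assoc\<close>);

  \<^item> unit: \<open>\<eta>\<close> picks the relation on \<open>\<I>\<close> that relates the identity state to all costates. The state
    of the trivial player is then forced and its condition is void, and
    plugging the identity into a costate changes nothing.

  The category need not be strict, so the partial evaluations carry unitors, and the equations
  rest on three coherence facts that the triangle and the pentagon imply:
  \<open>runit_tensor\<close>, \<open>lunit_tensor\<close> and \<open>lunit_unit_eq_runit_unit\<close>. The argument for them is Kelly's.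
\<close>

section \<open>Calculus of arrows in a category\<close>

lemma homD:
  assumes "f \<in> hom C X Y"
  shows "f \<in> Ar C" "src C f = X" "tgt C f = Y"
  using assms by (auto simp: hom_def)

context category
begin

text \<open>The axioms speak of hom-sets, whose middle objects are not determined by the term to be
  rewritten. Restated with \<open>src\<close> and \<open>tgt\<close>, they become conditional rewrite rules whose side
  conditions the simplifier discharges, so that it re-associates composites and computes
  their types in one pass.\<close>

lemma seq_typing:
  assumes "f \<in> Ar C" "g \<in> Ar C" "tgt C f = src C g"
  shows "f \<Zsemi> g \<in> Ar C" "src C (f \<Zsemi> g) = src C f" "tgt C (f \<Zsemi> g) = tgt C g"
  using seq_closed[of f "src C f" "src C g" g "tgt C g"] assms by (auto simp: hom_def)

lemma ident_typing:
  assumes "X \<in> Ob C"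
  shows "ident C X \<in> Ar C" "src C (ident C X) = X" "tgt C (ident C X) = X"
  using ident_closed[OF assms] by (auto simp: hom_def)

lemma ident_seq_Ar: "f \<in> Ar C \<Longrightarrow> src C f = X \<Longrightarrow> ident C X \<Zsemi> f = f"
  using ident_seq[of f X "tgt C f"] by (auto simp: hom_def)

lemma seq_ident_Ar: "f \<in> Ar C \<Longrightarrow> tgt C f = X \<Longrightarrow> f \<Zsemi> ident C X = f"
  using seq_ident[of f "src C f" X] by (auto simp: hom_def)

lemma seq_assoc_Ar:
  assumes "f \<in> Ar C" "g \<in> Ar C" "h \<in> Ar C" "tgt C f = src C g" "tgt C g = src C h"
  shows "(f \<Zsemi> g) \<Zsemi> h = f \<Zsemi> (g \<Zsemi> h)"
  using seq_assoc[of f "src C f" "src C g" g "src C h" h "tgt C h"] assms by (auto simp: hom_def)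

lemmas category_simps =
  src_closed tgt_closed seq_typing ident_typing ident_seq_Ar seq_ident_Ar seq_assoc_Ar

lemma inverses_unique:
  assumes "inverses C f g" "inverses C f h"
  shows "g = h"
proof -
  have "g = g \<Zsemi> (f \<Zsemi> h)"
    using assms by (simp add: inverses_def hom_def seq_ident_Ar)
  also have "\<dots> = (g \<Zsemi> f) \<Zsemi> h"
    using assms by (intro seq_assoc_Ar[symmetric]) (simp_all add: inverses_def hom_def)
  also have "\<dots> = h"
    using assms by (simp add: inverses_def hom_def ident_seq_Ar)
  finally show ?thesis .
qed

lemma inverses_inv_ar: "iso C f \<Longrightarrow> inverses C f (inv_ar C f)"
  unfolding iso_def inv_ar_def by (metis inverses_unique theI)

lemma inv_ar_props:
  assumes "iso C f" "f \<in> hom C X Y"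
  shows "inv_ar C f \<in> hom C Y X" "f \<Zsemi> inv_ar C f = ident C X" "inv_ar C f \<Zsemi> f = ident C Y"
  using inverses_inv_ar[OF assms(1)] assms(2) by (auto simp: inverses_def hom_def)

lemma iso_cancel_left:
  assumes "iso C f" "f \<Zsemi> g = f \<Zsemi> h" "f \<in> hom C X Y" "g \<in> hom C Y Z" "h \<in> hom C Y Z"
  shows "g = h"
proof -
  note i = inv_ar_props[OF assms(1,3)]
  have "g = (inv_ar C f \<Zsemi> f) \<Zsemi> g"
    using assms i by (simp add: ident_seq)
  also have "\<dots> = (inv_ar C f \<Zsemi> f) \<Zsemi> h"
    by (simp only: seq_assoc[OF i(1) assms(3,4)] seq_assoc[OF i(1) assms(3,5)] assms(2))
  also have "\<dots> = h"
    using assms i by (simp add: ident_seq)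
  finally show ?thesis .
qed

lemma iso_cancel_right:
  assumes "iso C f" "g \<Zsemi> f = h \<Zsemi> f" "f \<in> hom C X Y" "g \<in> hom C W X" "h \<in> hom C W X"
  shows "g = h"
proof -
  note i = inv_ar_props[OF assms(1,3)]
  have "g = g \<Zsemi> (f \<Zsemi> inv_ar C f)"
    using assms i by (simp add: seq_ident)
  also have "\<dots> = h \<Zsemi> (f \<Zsemi> inv_ar C f)"
    by (simp only: seq_assoc[OF assms(4,3) i(1), symmetric] seq_assoc[OF assms(5,3) i(1), symmetric] assms(2))
  also have "\<dots> = h"
    using assms i by (simp add: seq_ident)
  finally show ?thesis .
qed

end

section \<open>Coherence of the unitors\<close>

context monoidal_category
begin

abbreviation lunit_inv :: "'o \<Rightarrow> 'a" where "lunit_inv X \<equiv> inv_ar M (lunit M X)"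
abbreviation runit_inv :: "'o \<Rightarrow> 'a" where "runit_inv X \<equiv> inv_ar M (runit M X)"

lemma tensor_typing:
  assumes "f \<in> Ar M" "g \<in> Ar M"
  shows "f \<otimes> g \<in> Ar M" "src M (f \<otimes> g) = src M f \<otimes>\<^sub>o src M g"
    "tgt M (f \<otimes> g) = tgt M f \<otimes>\<^sub>o tgt M g"
  using tensor_ar_closed[of f "src M f" "tgt M f" g "src M g" "tgt M g"] assms
  by (auto simp: hom_def)

lemma tensor_seq_Ar:
  assumes "f \<in> Ar M" "f' \<in> Ar M" "g \<in> Ar M" "g' \<in> Ar M" "tgt M f = src M f'" "tgt M g = src M g'"
  shows "(f \<otimes> g) \<Zsemi> (f' \<otimes> g') = (f \<Zsemi> f') \<otimes> (g \<Zsemi> g')"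
  using tensor_seq[of f "src M f" "src M f'" f' "tgt M f'" g "src M g" "src M g'" g' "tgt M g'"] assms
  by (auto simp: hom_def)

text \<open>Interchange inside a longer composite that is already bracketed to the right.\<close>

lemma tensor_seq_seq:
  assumes "f \<in> Ar M" "f' \<in> Ar M" "g \<in> Ar M" "g' \<in> Ar M" "tgt M f = src M f'" "tgt M g = src M g'"
    "h \<in> Ar M" "src M h = tgt M f' \<otimes>\<^sub>o tgt M g'"
  shows "(f \<otimes> g) \<Zsemi> ((f' \<otimes> g') \<Zsemi> h) = ((f \<Zsemi> f') \<otimes> (g \<Zsemi> g')) \<Zsemi> h"
  using assms by (simp add: seq_assoc_Ar[symmetric] tensor_typing tensor_seq_Ar)

lemmas assoc_typing = assoc_closed[THEN homD(1)] assoc_closed[THEN homD(2)] assoc_closed[THEN homD(3)]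
lemmas lunit_typing = lunit_closed[THEN homD(1)] lunit_closed[THEN homD(2)] lunit_closed[THEN homD(3)]
lemmas runit_typing = runit_closed[THEN homD(1)] runit_closed[THEN homD(2)] runit_closed[THEN homD(3)]

lemma lunit_inv_props:
  assumes "X \<in> Ob M"
  shows "lunit_inv X \<in> Ar M" "src M (lunit_inv X) = X" "tgt M (lunit_inv X) = \<I> \<otimes>\<^sub>o X"
    "lunit M X \<Zsemi> lunit_inv X = ident M (\<I> \<otimes>\<^sub>o X)" "lunit_inv X \<Zsemi> lunit M X = ident M X"
  using inv_ar_props[OF lunit_iso lunit_closed, OF assms assms] by (auto simp: hom_def)

lemma runit_inv_props:
  assumes "X \<in> Ob M"
  shows "runit_inv X \<in> Ar M" "src M (runit_inv X) = X" "tgt M (runit_inv X) = X \<otimes>\<^sub>o \<I>"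
    "runit M X \<Zsemi> runit_inv X = ident M (X \<otimes>\<^sub>o \<I>)" "runit_inv X \<Zsemi> runit M X = ident M X"
  using inv_ar_props[OF runit_iso runit_closed, OF assms assms] by (auto simp: hom_def)

text \<open>Beyond the typing rules, these merge adjacent tensors by the interchange law. The rules
  contain neither naturality nor the coherence axioms, which are applied by hand where needed.\<close>

lemmas monoidal_simps = category_simps unit_closed tensor_ob_closed tensor_typing
  tensor_seq_Ar tensor_seq_seq tensor_ident assoc_typing lunit_typing runit_typing
  lunit_inv_props runit_inv_props

lemma lunit_inv_natural:
  assumes f: "f \<in> hom M X Y"
  shows "f \<Zsemi> lunit_inv Y = lunit_inv X \<Zsemi> (ident M \<I> \<otimes> f)"
proof (rule iso_cancel_right[OF lunit_iso _ lunit_closed])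
  note t = homD[OF f] src_closed[of f] tgt_closed[of f]
  show Y: "Y \<in> Ob M" using t by simp
  then show "Y \<in> Ob M" .
  have X: "X \<in> Ob M" using t by simp
  have "(lunit_inv X \<Zsemi> (ident M \<I> \<otimes> f)) \<Zsemi> lunit M Y = lunit_inv X \<Zsemi> (lunit M X \<Zsemi> f)"
    using t X Y by (simp add: monoidal_simps lunit_natural[OF f])
  also have "\<dots> = (lunit_inv X \<Zsemi> lunit M X) \<Zsemi> f"
    using t X Y by (simp add: category_simps lunit_typing lunit_inv_props(1-3))
  finally show "(f \<Zsemi> lunit_inv Y) \<Zsemi> lunit M Y = (lunit_inv X \<Zsemi> (ident M \<I> \<otimes> f)) \<Zsemi> lunit M Y"
    using t X Y by (simp add: monoidal_simps)
  show "f \<Zsemi> lunit_inv Y \<in> hom M X (\<I> \<otimes>\<^sub>o Y)"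
    "lunit_inv X \<Zsemi> (ident M \<I> \<otimes> f) \<in> hom M X (\<I> \<otimes>\<^sub>o Y)"
    using t X Y by (simp_all add: monoidal_simps hom_def)
qed

lemma runit_inv_natural:
  assumes f: "f \<in> hom M X Y"
  shows "f \<Zsemi> runit_inv Y = runit_inv X \<Zsemi> (f \<otimes> ident M \<I>)"
proof (rule iso_cancel_right[OF runit_iso _ runit_closed])
  note t = homD[OF f] src_closed[of f] tgt_closed[of f]
  show Y: "Y \<in> Ob M" using t by simp
  then show "Y \<in> Ob M" .
  have X: "X \<in> Ob M" using t by simp
  have "(runit_inv X \<Zsemi> (f \<otimes> ident M \<I>)) \<Zsemi> runit M Y = runit_inv X \<Zsemi> (runit M X \<Zsemi> f)"
    using t X Y by (simp add: monoidal_simps runit_natural[OF f])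
  also have "\<dots> = (runit_inv X \<Zsemi> runit M X) \<Zsemi> f"
    using t X Y by (simp add: category_simps runit_typing runit_inv_props(1-3))
  finally show "(f \<Zsemi> runit_inv Y) \<Zsemi> runit M Y = (runit_inv X \<Zsemi> (f \<otimes> ident M \<I>)) \<Zsemi> runit M Y"
    using t X Y by (simp add: monoidal_simps)
  show "f \<Zsemi> runit_inv Y \<in> hom M X (Y \<otimes>\<^sub>o \<I>)"
    "runit_inv X \<Zsemi> (f \<otimes> ident M \<I>) \<in> hom M X (Y \<otimes>\<^sub>o \<I>)"
    using t X Y by (simp_all add: monoidal_simps hom_def)
qed

text \<open>Tensoring with the unit on either side is naturally isomorphic to the identity functor, hence
  faithful. Kelly's argument proves its equations after such a tensoring, where the pentagon
  applies.\<close>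

lemma unit_tensor_faithful:
  assumes f: "f \<in> hom M X Y" and g: "g \<in> hom M X Y" and eq: "ident M \<I> \<otimes> f = ident M \<I> \<otimes> g"
  shows "f = g"
proof (rule iso_cancel_left[OF lunit_iso _ lunit_closed f g])
  show "X \<in> Ob M" "X \<in> Ob M" using homD[OF f] src_closed by auto
  show "lunit M X \<Zsemi> f = lunit M X \<Zsemi> g"
    using lunit_natural[OF f] lunit_natural[OF g] eq by simp
qed

lemma tensor_unit_faithful:
  assumes f: "f \<in> hom M X Y" and g: "g \<in> hom M X Y" and eq: "f \<otimes> ident M \<I> = g \<otimes> ident M \<I>"
  shows "f = g"
proof (rule iso_cancel_left[OF runit_iso _ runit_closed f g])
  show "X \<in> Ob M" "X \<in> Ob M" using homD[OF f] src_closed by auto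
  show "runit M X \<Zsemi> f = runit M X \<Zsemi> g"
    using runit_natural[OF f] runit_natural[OF g] eq by simp
qed

lemma tensor_iso:
  assumes "iso M f" "iso M g"
  shows "iso M (f \<otimes> g)"
proof -
  obtain f' g' where "inverses M f f'" "inverses M g g'"
    using assms unfolding iso_def by blast
  then have "inverses M (f \<otimes> g) (f' \<otimes> g')"
    by (simp add: inverses_def hom_def monoidal_simps)
  then show ?thesis unfolding iso_def by blast
qed

lemma ident_iso: "X \<in> Ob M \<Longrightarrow> iso M (ident M X)"
  unfolding iso_def inverses_def by (rule exI[of _ "ident M X"]) (simp add: hom_def monoidal_simps)

lemma assoc_natural_Ar:
  assumes "f \<in> Ar M" "g \<in> Ar M" "h \<in> Ar M"
  shows "((f \<otimes> g) \<otimes> h) \<Zsemi> assoc M (tgt M f) (tgt M g) (tgt M h)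
    = assoc M (src M f) (src M g) (src M h) \<Zsemi> (f \<otimes> (g \<otimes> h))"
  by (rule assoc_natural) (use assms in \<open>auto simp: hom_def\<close>)

text \<open>Tensor both sides with \<open>\<I>\<close> on the right and compose with an associator. The pentagon for
  \<open>X, Y, \<I>, \<I>\<close> then relates the two instances of the triangle, at \<open>Y, \<I>\<close> and at \<open>X \<otimes> Y, \<I>\<close>.\<close>

lemma runit_tensor:
  assumes X: "X \<in> Ob M" and Y: "Y \<in> Ob M"
  shows "assoc M X Y \<I> \<Zsemi> (ident M X \<otimes> runit M Y) = runit M (X \<otimes>\<^sub>o Y)" (is "?l = ?r")
proof (rule tensor_unit_faithful[OF _ _ iso_cancel_right[OF assoc_iso[OF X Y unit_closed] _ assoc_closed[OF X Y unit_closed]]])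
  let ?\<alpha> = "assoc M" and ?i = "ident M"
  show "?l \<in> hom M ((X \<otimes>\<^sub>o Y) \<otimes>\<^sub>o \<I>) (X \<otimes>\<^sub>o Y)" "?r \<in> hom M ((X \<otimes>\<^sub>o Y) \<otimes>\<^sub>o \<I>) (X \<otimes>\<^sub>o Y)"
    "?l \<otimes> ?i \<I> \<in> hom M (((X \<otimes>\<^sub>o Y) \<otimes>\<^sub>o \<I>) \<otimes>\<^sub>o \<I>) ((X \<otimes>\<^sub>o Y) \<otimes>\<^sub>o \<I>)"
    "?r \<otimes> ?i \<I> \<in> hom M (((X \<otimes>\<^sub>o Y) \<otimes>\<^sub>o \<I>) \<otimes>\<^sub>o \<I>) ((X \<otimes>\<^sub>o Y) \<otimes>\<^sub>o \<I>)"
    using X Y by (simp_all add: monoidal_simps hom_def)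
  have "(?l \<otimes> ?i \<I>) \<Zsemi> ?\<alpha> X Y \<I>
      = (?\<alpha> X Y \<I> \<otimes> ?i \<I>) \<Zsemi> (((?i X \<otimes> runit M Y) \<otimes> ?i \<I>) \<Zsemi> ?\<alpha> X Y \<I>)"
    using X Y by (simp add: monoidal_simps)
  also have "\<dots> = (?\<alpha> X Y \<I> \<otimes> ?i \<I>) \<Zsemi> (?\<alpha> X (Y \<otimes>\<^sub>o \<I>) \<I> \<Zsemi> (?i X \<otimes> (runit M Y \<otimes> ?i \<I>)))"
    using X Y assoc_natural_Ar[of "?i X" "runit M Y" "?i \<I>"] by (simp add: monoidal_simps)
  also have "\<dots> = (?\<alpha> X Y \<I> \<otimes> ?i \<I>) \<Zsemi> (?\<alpha> X (Y \<otimes>\<^sub>o \<I>) \<I> \<Zsemi>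
      (?i X \<otimes> (?\<alpha> Y \<I> \<I> \<Zsemi> (?i Y \<otimes> lunit M \<I>))))"
    using X Y by (simp add: triangle unit_closed)
  also have "\<dots> = ((?\<alpha> X Y \<I> \<otimes> ?i \<I>) \<Zsemi> ?\<alpha> X (Y \<otimes>\<^sub>o \<I>) \<I> \<Zsemi> (?i X \<otimes> ?\<alpha> Y \<I> \<I>))
      \<Zsemi> (?i X \<otimes> (?i Y \<otimes> lunit M \<I>))"
    using X Y by (simp add: monoidal_simps)
  also have "\<dots> = ?\<alpha> (X \<otimes>\<^sub>o Y) \<I> \<I> \<Zsemi> (?\<alpha> X Y (\<I> \<otimes>\<^sub>o \<I>) \<Zsemi> (?i X \<otimes> (?i Y \<otimes> lunit M \<I>)))"
    using X Y by (simp only: pentagon unit_closed) (simp add: monoidal_simps)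
  also have "\<dots> = ?\<alpha> (X \<otimes>\<^sub>o Y) \<I> \<I> \<Zsemi> ((?i (X \<otimes>\<^sub>o Y) \<otimes> lunit M \<I>) \<Zsemi> ?\<alpha> X Y \<I>)"
    using X Y assoc_natural_Ar[of "?i X" "?i Y" "lunit M \<I>"] by (simp add: monoidal_simps)
  also have "\<dots> = (?\<alpha> (X \<otimes>\<^sub>o Y) \<I> \<I> \<Zsemi> (?i (X \<otimes>\<^sub>o Y) \<otimes> lunit M \<I>)) \<Zsemi> ?\<alpha> X Y \<I>"
    using X Y by (simp add: monoidal_simps)
  also have "\<dots> = (?r \<otimes> ?i \<I>) \<Zsemi> ?\<alpha> X Y \<I>"
    using X Y by (simp add: triangle unit_closed tensor_ob_closed)
  finally show "(?l \<otimes> ?i \<I>) \<Zsemi> ?\<alpha> X Y \<I> = (?r \<otimes> ?i \<I>) \<Zsemi> ?\<alpha> X Y \<I>" .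
qed

text \<open>The mirror image: tensor with \<open>\<I>\<close> on the left and use the pentagon for \<open>\<I>, \<I>, X, Y\<close>, with the
  triangle at \<open>\<I>, X\<close> and at \<open>\<I>, X \<otimes> Y\<close>.\<close>

lemma lunit_tensor:
  assumes X: "X \<in> Ob M" and Y: "Y \<in> Ob M"
  shows "assoc M \<I> X Y \<Zsemi> lunit M (X \<otimes>\<^sub>o Y) = lunit M X \<otimes> ident M Y" (is "?l = ?r")
proof -
  let ?\<alpha> = "assoc M" and ?i = "ident M"
  have I: "\<I> \<in> Ob M" by (rule unit_closed)
  let ?s = "?\<alpha> \<I> \<I> X \<otimes> ?i Y" and ?t = "?\<alpha> \<I> (\<I> \<otimes>\<^sub>o X) Y"
  have "?s \<Zsemi> (?t \<Zsemi> (?i \<I> \<otimes> ?l))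
      = (?s \<Zsemi> ?t \<Zsemi> (?i \<I> \<otimes> ?\<alpha> \<I> X Y)) \<Zsemi> (?i \<I> \<otimes> lunit M (X \<otimes>\<^sub>o Y))"
    using X Y by (simp add: monoidal_simps)
  also have "\<dots> = ?\<alpha> (\<I> \<otimes>\<^sub>o \<I>) X Y \<Zsemi> (?\<alpha> \<I> \<I> (X \<otimes>\<^sub>o Y) \<Zsemi> (?i \<I> \<otimes> lunit M (X \<otimes>\<^sub>o Y)))"
    using X Y by (simp only: pentagon unit_closed) (simp add: monoidal_simps)
  also have "\<dots> = ?\<alpha> (\<I> \<otimes>\<^sub>o \<I>) X Y \<Zsemi> (runit M \<I> \<otimes> (?i X \<otimes> ?i Y))"
    using X Y by (simp add: triangle unit_closed tensor_ob_closed tensor_ident)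
  also have "\<dots> = ((runit M \<I> \<otimes> ?i X) \<otimes> ?i Y) \<Zsemi> ?\<alpha> \<I> X Y"
    using X Y assoc_natural_Ar[of "runit M \<I>" "?i X" "?i Y"] by (simp add: monoidal_simps)
  also have "\<dots> = ((?\<alpha> \<I> \<I> X \<Zsemi> (?i \<I> \<otimes> lunit M X)) \<otimes> ?i Y) \<Zsemi> ?\<alpha> \<I> X Y"
    using X Y by (simp add: triangle unit_closed)
  also have "\<dots> = ?s \<Zsemi> (((?i \<I> \<otimes> lunit M X) \<otimes> ?i Y) \<Zsemi> ?\<alpha> \<I> X Y)"
    using X Y by (simp add: monoidal_simps)
  also have "\<dots> = ?s \<Zsemi> (?t \<Zsemi> (?i \<I> \<otimes> ?r))"
    using X Y assoc_natural_Ar[of "?i \<I>" "lunit M X" "?i Y"] by (simp add: monoidal_simps)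
  finally have *: "?s \<Zsemi> (?t \<Zsemi> (?i \<I> \<otimes> ?l)) = ?s \<Zsemi> (?t \<Zsemi> (?i \<I> \<otimes> ?r))" .
  have l: "?l \<in> hom M ((\<I> \<otimes>\<^sub>o X) \<otimes>\<^sub>o Y) (X \<otimes>\<^sub>o Y)" and r: "?r \<in> hom M ((\<I> \<otimes>\<^sub>o X) \<otimes>\<^sub>o Y) (X \<otimes>\<^sub>o Y)"
    using X Y by (simp_all add: monoidal_simps hom_def)
  have IX: "\<I> \<otimes>\<^sub>o X \<in> Ob M" using X I by (rule_tac tensor_ob_closed)
  note t = assoc_closed[OF I IX Y]
  note s = tensor_ar_closed[OF assoc_closed[OF I I X] ident_closed[OF Y]]
  note li = tensor_ar_closed[OF ident_closed[OF I] l] and ri = tensor_ar_closed[OF ident_closed[OF I] r]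
  have "?t \<Zsemi> (?i \<I> \<otimes> ?l) = ?t \<Zsemi> (?i \<I> \<otimes> ?r)"
    by (rule iso_cancel_left[OF tensor_iso[OF assoc_iso[OF I I X] ident_iso[OF Y]] * s
          seq_closed[OF t li] seq_closed[OF t ri]])
  then have "?i \<I> \<otimes> ?l = ?i \<I> \<otimes> ?r"
    by (rule iso_cancel_left[OF assoc_iso[OF I IX Y] _ t li ri])
  then show ?thesis by (rule unit_tensor_faithful[OF l r])
qed

text \<open>Naturality of the left unitor at itself gives \<open>\<I> \<otimes> \<lambda>\<^sub>\<I> = \<lambda>\<^sub>\<I>\<^sub>\<otimes>\<^sub>\<I>\<close>. So
  \<open>lunit_tensor\<close> and the triangle express \<open>\<lambda>\<^sub>\<I> \<otimes> \<I>\<close> and \<open>\<rho>\<^sub>\<I> \<otimes> \<I>\<close> by the same composite.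
  This identity makes the left-right asymmetric definition of \<open>tensor_state\<close> harmless.\<close>

lemma lunit_unit_eq_runit_unit: "lunit M \<I> = runit M \<I>"
proof (rule tensor_unit_faithful[OF lunit_closed runit_closed])
  have I: "\<I> \<in> Ob M" by (rule unit_closed)
  have II: "\<I> \<otimes>\<^sub>o \<I> \<in> Ob M" by (intro tensor_ob_closed I)
  have "ident M \<I> \<otimes> lunit M \<I> = lunit M (\<I> \<otimes>\<^sub>o \<I>)"
    by (rule iso_cancel_right[OF lunit_iso[OF I] lunit_natural[OF lunit_closed[OF I]] lunit_closed[OF I]
          tensor_ar_closed[OF ident_closed[OF I] lunit_closed[OF I]] lunit_closed[OF II]])
  then show "lunit M \<I> \<otimes> ident M \<I> = runit M \<I> \<otimes> ident M \<I>"
    using lunit_tensor[OF I I] triangle[OF I I] by simp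
qed (rule unit_closed)+

lemma runit_inv_tensor:
  assumes X: "X \<in> Ob M" and Y: "Y \<in> Ob M"
  shows "runit_inv (X \<otimes>\<^sub>o Y) \<Zsemi> assoc M X Y \<I> = ident M X \<otimes> runit_inv Y"
proof -
  have "runit_inv (X \<otimes>\<^sub>o Y) \<Zsemi> assoc M X Y \<I>
      = runit_inv (X \<otimes>\<^sub>o Y) \<Zsemi> (assoc M X Y \<I> \<Zsemi> ((ident M X \<otimes> runit M Y) \<Zsemi> (ident M X \<otimes> runit_inv Y)))"
    using X Y by (simp add: monoidal_simps)
  also have "\<dots> = (runit_inv (X \<otimes>\<^sub>o Y) \<Zsemi> (assoc M X Y \<I> \<Zsemi> (ident M X \<otimes> runit M Y))) \<Zsemi> (ident M X \<otimes> runit_inv Y)"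
    using X Y by (simp add: monoidal_simps)
  also have "\<dots> = ident M X \<otimes> runit_inv Y"
    unfolding runit_tensor[OF X Y] using X Y by (simp add: monoidal_simps)
  finally show ?thesis .
qed

lemma lunit_inv_tensor:
  assumes X: "X \<in> Ob M" and Y: "Y \<in> Ob M"
  shows "(lunit_inv X \<otimes> ident M Y) \<Zsemi> assoc M \<I> X Y = lunit_inv (X \<otimes>\<^sub>o Y)"
proof -
  have "(lunit_inv X \<otimes> ident M Y) \<Zsemi> assoc M \<I> X Y
      = (lunit_inv X \<otimes> ident M Y) \<Zsemi> (assoc M \<I> X Y \<Zsemi> (lunit M (X \<otimes>\<^sub>o Y) \<Zsemi> lunit_inv (X \<otimes>\<^sub>o Y)))"
    using X Y by (simp add: monoidal_simps)
  also have "\<dots> = ((lunit_inv X \<otimes> ident M Y) \<Zsemi> (assoc M \<I> X Y \<Zsemi> lunit M (X \<otimes>\<^sub>o Y))) \<Zsemi> lunit_inv (X \<otimes>\<^sub>o Y)"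
    using X Y by (simp add: monoidal_simps)
  also have "\<dots> = lunit_inv (X \<otimes>\<^sub>o Y)"
    unfolding lunit_tensor[OF X Y] using X Y by (simp add: monoidal_simps)
  finally show ?thesis .
qed


section \<open>Tensors of states and partial evaluations of costates\<close>

lemma tensor_state_closed:
  "x \<in> hom M \<I> X \<Longrightarrow> y \<in> hom M \<I> Y \<Longrightarrow> tensor_state M x y \<in> hom M \<I> (X \<otimes>\<^sub>o Y)"
  unfolding tensor_state_def hom_def using unit_closed by (auto simp: monoidal_simps)

lemma costate_left_closed:
  assumes "X \<in> Ob M" "y \<in> hom M \<I> Y" "k \<in> hom M (X \<otimes>\<^sub>o Y) \<I>"
  shows "costate_left M X y k \<in> hom M X \<I>"
  using assms unit_closed unfolding costate_left_def hom_def by (auto simp: monoidal_simps)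

lemma costate_right_closed:
  assumes "Y \<in> Ob M" "x \<in> hom M \<I> X" "k \<in> hom M (X \<otimes>\<^sub>o Y) \<I>"
  shows "costate_right M Y x k \<in> hom M Y \<I>"
  using assms unit_closed unfolding costate_right_def hom_def by (auto simp: monoidal_simps)

lemma tensor_state_natural:
  assumes "x \<in> hom M \<I> X" "y \<in> hom M \<I> Y" "f \<in> hom M X X'" "g \<in> hom M Y Y'"
  shows "tensor_state M x y \<Zsemi> (f \<otimes> g) = tensor_state M (x \<Zsemi> f) (y \<Zsemi> g)"
  using assms unit_closed unfolding tensor_state_def hom_def by (auto simp: monoidal_simps)

text \<open>Reparametrising the payoff along \<open>f \<otimes> g\<close> and plugging in \<open>y\<close> is the same as plugging
  the reparametrised state \<open>y \<Zsemi> g\<close> into the original payoff: \<open>f\<close> slides out of the tensor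
  past the inverse unitor.\<close>

lemma costate_left_natural:
  assumes y: "y \<in> hom M \<I> Y" and f: "f \<in> hom M X X'" and g: "g \<in> hom M Y Y'"
    and k: "k \<in> hom M (X' \<otimes>\<^sub>o Y') \<I>"
  shows "costate_left M X y ((f \<otimes> g) \<Zsemi> k) = f \<Zsemi> costate_left M X' (y \<Zsemi> g) k"
proof -
  note t = homD[OF y] homD[OF f] homD[OF g] homD[OF k]
  have ob: "X \<in> Ob M" "X' \<in> Ob M" "Y \<in> Ob M" "Y' \<in> Ob M"
    using t src_closed tgt_closed by auto
  have "costate_left M X y ((f \<otimes> g) \<Zsemi> k) = (runit_inv X \<Zsemi> (f \<otimes> ident M \<I>)) \<Zsemi> (ident M X' \<otimes> (y \<Zsemi> g)) \<Zsemi> k"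
    unfolding costate_left_def using t ob by (simp add: monoidal_simps)
  also have "\<dots> = f \<Zsemi> costate_left M X' (y \<Zsemi> g) k"
    unfolding costate_left_def runit_inv_natural[OF f, symmetric] using t ob by (simp add: monoidal_simps)
  finally show ?thesis .
qed

lemma costate_right_natural:
  assumes x: "x \<in> hom M \<I> X" and f: "f \<in> hom M X X'" and g: "g \<in> hom M Y Y'"
    and k: "k \<in> hom M (X' \<otimes>\<^sub>o Y') \<I>"
  shows "costate_right M Y x ((f \<otimes> g) \<Zsemi> k) = g \<Zsemi> costate_right M Y' (x \<Zsemi> f) k"
proof -
  note t = homD[OF x] homD[OF f] homD[OF g] homD[OF k]
  have ob: "X \<in> Ob M" "X' \<in> Ob M" "Y \<in> Ob M" "Y' \<in> Ob M"
    using t src_closed tgt_closed by auto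
  have "costate_right M Y x ((f \<otimes> g) \<Zsemi> k) = (lunit_inv Y \<Zsemi> (ident M \<I> \<otimes> g)) \<Zsemi> ((x \<Zsemi> f) \<otimes> ident M Y') \<Zsemi> k"
    unfolding costate_right_def using t ob by (simp add: monoidal_simps)
  also have "\<dots> = g \<Zsemi> costate_right M Y' (x \<Zsemi> f) k"
    unfolding costate_right_def lunit_inv_natural[OF g, symmetric] using t ob by (simp add: monoidal_simps)
  finally show ?thesis .
qed

text \<open>In the following, \<open>k\<close> is a payoff for three players. The laxator composed one way evaluates
  \<open>\<alpha> \<Zsemi> k\<close> on \<open>(X \<otimes> Y) \<otimes> Z\<close>, and the other way evaluates \<open>k\<close> itself.\<close>

context
  fixes X Y Z x y z k
  assumes ob: "X \<in> Ob M" "Y \<in> Ob M" "Z \<in> Ob M"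
    and x: "x \<in> hom M \<I> X" and y: "y \<in> hom M \<I> Y" and z: "z \<in> hom M \<I> Z"
    and k: "k \<in> hom M (X \<otimes>\<^sub>o (Y \<otimes>\<^sub>o Z)) \<I>"
begin

lemmas state_typing = homD[OF x] homD[OF y] homD[OF z] homD[OF k] ob unit_closed

lemma tensor_state_assoc:
  "tensor_state M (tensor_state M x y) z \<Zsemi> assoc M X Y Z = tensor_state M x (tensor_state M y z)"
proof -
  have "tensor_state M (tensor_state M x y) z \<Zsemi> assoc M X Y Z
      = lunit_inv \<I> \<Zsemi> ((lunit_inv \<I> \<otimes> ident M \<I>) \<Zsemi> (((x \<otimes> y) \<otimes> z) \<Zsemi> assoc M X Y Z))"
    unfolding tensor_state_def using state_typing by (simp add: monoidal_simps)
  also have "\<dots> = lunit_inv \<I> \<Zsemi> (((lunit_inv \<I> \<otimes> ident M \<I>) \<Zsemi> assoc M \<I> \<I> \<I>) \<Zsemi> (x \<otimes> (y \<otimes> z)))"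
    unfolding assoc_natural[OF x y z] using state_typing by (simp add: monoidal_simps)
  also have "\<dots> = (lunit_inv \<I> \<Zsemi> lunit_inv (\<I> \<otimes>\<^sub>o \<I>)) \<Zsemi> (x \<otimes> (y \<otimes> z))"
    unfolding lunit_inv_tensor[OF unit_closed unit_closed] using state_typing by (simp add: monoidal_simps)
  also have "lunit_inv \<I> \<Zsemi> lunit_inv (\<I> \<otimes>\<^sub>o \<I>) = lunit_inv \<I> \<Zsemi> (ident M \<I> \<otimes> lunit_inv \<I>)"
    by (rule lunit_inv_natural) (use state_typing in \<open>simp add: monoidal_simps hom_def\<close>)
  also have "\<dots> \<Zsemi> (x \<otimes> (y \<otimes> z)) = tensor_state M x (tensor_state M y z)"
    unfolding tensor_state_def using state_typing by (simp add: monoidal_simps)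
  finally show ?thesis .
qed

text \<open>Plugging in \<open>z\<close> at the outer level of \<open>(X \<otimes> Y) \<otimes> Z\<close> is plugging it in next to \<open>Y\<close> alone. This form
  has no associator left, and the evaluations for the first and the second player both use it.\<close>

lemma costate_left_assoc:
  "costate_left M (X \<otimes>\<^sub>o Y) z (assoc M X Y Z \<Zsemi> k)
    = (ident M X \<otimes> (runit_inv Y \<Zsemi> (ident M Y \<otimes> z))) \<Zsemi> k"
proof -
  have "costate_left M (X \<otimes>\<^sub>o Y) z (assoc M X Y Z \<Zsemi> k)
      = runit_inv (X \<otimes>\<^sub>o Y) \<Zsemi> ((((ident M X \<otimes> ident M Y) \<otimes> z) \<Zsemi> assoc M X Y Z) \<Zsemi> k)"
    unfolding costate_left_def using state_typing by (simp add: monoidal_simps)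
  also have "\<dots> = (runit_inv (X \<otimes>\<^sub>o Y) \<Zsemi> assoc M X Y \<I>) \<Zsemi> ((ident M X \<otimes> (ident M Y \<otimes> z)) \<Zsemi> k)"
    unfolding assoc_natural[OF ident_closed[OF ob(1)] ident_closed[OF ob(2)] z]
    using state_typing by (simp add: monoidal_simps)
  also have "\<dots> = (ident M X \<otimes> (runit_inv Y \<Zsemi> (ident M Y \<otimes> z))) \<Zsemi> k"
    unfolding runit_inv_tensor[OF ob(1,2)] using state_typing by (simp add: monoidal_simps)
  finally show ?thesis .
qed

text \<open>What the first player faces. Sliding \<open>y\<close> past \<open>\<rho>\<inverse>\<close> produces \<open>\<rho>\<^sub>\<I>\<inverse>\<close> where
  \<open>tensor_state\<close> has \<open>\<lambda>\<^sub>\<I>\<inverse>\<close>, hence the appeal to \<open>lunit_unit_eq_runit_unit\<close>.\<close>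

lemma costate_left_left:
  "costate_left M X y (costate_left M (X \<otimes>\<^sub>o Y) z (assoc M X Y Z \<Zsemi> k))
    = costate_left M X (tensor_state M y z) k"
proof -
  have "costate_left M X y (costate_left M (X \<otimes>\<^sub>o Y) z (assoc M X Y Z \<Zsemi> k))
      = runit_inv X \<Zsemi> (ident M X \<otimes> ((y \<Zsemi> runit_inv Y) \<Zsemi> (ident M Y \<otimes> z))) \<Zsemi> k"
    unfolding costate_left_assoc unfolding costate_left_def using state_typing by (simp add: monoidal_simps)
  also have "\<dots> = costate_left M X (tensor_state M y z) k"
    unfolding runit_inv_natural[OF y] costate_left_def tensor_state_def
    using state_typing by (simp add: monoidal_simps lunit_unit_eq_runit_unit)
  finally show ?thesis .
qed

text \<open>What the second player faces: \<open>x\<close> and \<open>z\<close> act on different factors, so the order of plugging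
  them in does not matter.\<close>

lemma costate_right_left:
  "costate_right M Y x (costate_left M (X \<otimes>\<^sub>o Y) z (assoc M X Y Z \<Zsemi> k))
    = costate_left M Y z (costate_right M (Y \<otimes>\<^sub>o Z) x k)"
proof -
  let ?h = "runit_inv Y \<Zsemi> (ident M Y \<otimes> z)"
  have h: "?h \<in> hom M Y (Y \<otimes>\<^sub>o Z)"
    using state_typing by (simp add: monoidal_simps hom_def)
  have "costate_right M Y x (costate_left M (X \<otimes>\<^sub>o Y) z (assoc M X Y Z \<Zsemi> k))
      = (lunit_inv Y \<Zsemi> (ident M \<I> \<otimes> ?h)) \<Zsemi> ((x \<otimes> ident M (Y \<otimes>\<^sub>o Z)) \<Zsemi> k)"
    unfolding costate_left_assoc costate_right_def using state_typing by (simp add: monoidal_simps)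
  also have "\<dots> = costate_left M Y z (costate_right M (Y \<otimes>\<^sub>o Z) x k)"
    unfolding lunit_inv_natural[OF h, symmetric] costate_left_def costate_right_def
    using state_typing by (simp add: monoidal_simps)
  finally show ?thesis .
qed

text \<open>What the third player faces. Moving the associator to the front turns the inverse unitor inside
  \<open>x \<otimes> y\<close> into \<open>\<lambda>\<inverse>\<close> at \<open>\<I> \<otimes> Z\<close>, past which \<open>y\<close> slides.\<close>

lemma costate_right_right:
  "costate_right M Z (tensor_state M x y) (assoc M X Y Z \<Zsemi> k)
    = costate_right M Z y (costate_right M (Y \<otimes>\<^sub>o Z) x k)"
proof -
  have yZ: "y \<otimes> ident M Z \<in> hom M (\<I> \<otimes>\<^sub>o Z) (Y \<otimes>\<^sub>o Z)"
    using state_typing by (simp add: monoidal_simps hom_def)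
  have "costate_right M Z (tensor_state M x y) (assoc M X Y Z \<Zsemi> k)
      = lunit_inv Z \<Zsemi> ((lunit_inv \<I> \<otimes> ident M Z) \<Zsemi> ((((x \<otimes> y) \<otimes> ident M Z) \<Zsemi> assoc M X Y Z) \<Zsemi> k))"
    unfolding costate_right_def tensor_state_def using state_typing by (simp add: monoidal_simps)
  also have "\<dots> = lunit_inv Z \<Zsemi> (((lunit_inv \<I> \<otimes> ident M Z) \<Zsemi> assoc M \<I> \<I> Z) \<Zsemi> ((x \<otimes> (y \<otimes> ident M Z)) \<Zsemi> k))"
    unfolding assoc_natural[OF x y ident_closed[OF ob(3)]]
    using state_typing by (simp add: monoidal_simps)
  also have "\<dots> = lunit_inv Z \<Zsemi> ((lunit_inv (\<I> \<otimes>\<^sub>o Z) \<Zsemi> (ident M \<I> \<otimes> (y \<otimes> ident M Z))) \<Zsemi> ((x \<otimes> ident M (Y \<otimes>\<^sub>o Z)) \<Zsemi> k))"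
    unfolding lunit_inv_tensor[OF unit_closed ob(3)] using state_typing by (simp add: monoidal_simps)
  also have "\<dots> = costate_right M Z y (costate_right M (Y \<otimes>\<^sub>o Z) x k)"
    unfolding lunit_inv_natural[OF yZ, symmetric] costate_right_def
    using state_typing by (simp add: monoidal_simps)
  finally show ?thesis .
qed

end

lemma tensor_state_ident_left:
  assumes y: "y \<in> hom M \<I> Y"
  shows "tensor_state M (ident M \<I>) y \<Zsemi> lunit M Y = y"
proof -
  note t = homD[OF y] unit_closed
  have ob: "Y \<in> Ob M" using t tgt_closed by auto
  have "tensor_state M (ident M \<I>) y \<Zsemi> lunit M Y = lunit_inv \<I> \<Zsemi> ((ident M \<I> \<otimes> y) \<Zsemi> lunit M Y)"
    unfolding tensor_state_def using t ob by (simp add: monoidal_simps)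
  also have "\<dots> = (lunit_inv \<I> \<Zsemi> lunit M \<I>) \<Zsemi> y"
    unfolding lunit_natural[OF y] using t ob by (intro seq_assoc_Ar[symmetric]) (simp_all add: monoidal_simps)
  also have "\<dots> = y" using t by (simp add: monoidal_simps)
  finally show ?thesis .
qed

lemma tensor_state_ident_right:
  assumes x: "x \<in> hom M \<I> X"
  shows "tensor_state M x (ident M \<I>) \<Zsemi> runit M X = x"
proof -
  note t = homD[OF x] unit_closed
  have ob: "X \<in> Ob M" using t tgt_closed by auto
  have "tensor_state M x (ident M \<I>) \<Zsemi> runit M X = runit_inv \<I> \<Zsemi> ((x \<otimes> ident M \<I>) \<Zsemi> runit M X)"
    unfolding tensor_state_def lunit_unit_eq_runit_unit using t ob by (simp add: monoidal_simps)
  also have "\<dots> = (runit_inv \<I> \<Zsemi> runit M \<I>) \<Zsemi> x"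
    unfolding runit_natural[OF x] using t ob by (intro seq_assoc_Ar[symmetric]) (simp_all add: monoidal_simps)
  also have "\<dots> = x" using t by (simp add: monoidal_simps)
  finally show ?thesis .
qed

lemma costate_right_ident:
  assumes k: "k \<in> hom M Y \<I>"
  shows "costate_right M Y (ident M \<I>) (lunit M Y \<Zsemi> k) = k"
proof -
  note t = homD[OF k] unit_closed
  have ob: "Y \<in> Ob M" using t src_closed by auto
  have "costate_right M Y (ident M \<I>) (lunit M Y \<Zsemi> k) = (lunit_inv Y \<Zsemi> lunit M Y) \<Zsemi> k"
    unfolding costate_right_def using t ob by (simp add: category_simps monoidal_simps(8-) del: lunit_inv_props(5))
  also have "\<dots> = k" using t ob by (simp add: monoidal_simps)
  finally show ?thesis .
qed

lemma costate_left_ident: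
  assumes k: "k \<in> hom M X \<I>"
  shows "costate_left M X (ident M \<I>) (runit M X \<Zsemi> k) = k"
proof -
  note t = homD[OF k] unit_closed
  have ob: "X \<in> Ob M" using t src_closed by auto
  have "costate_left M X (ident M \<I>) (runit M X \<Zsemi> k) = (runit_inv X \<Zsemi> runit M X) \<Zsemi> k"
    unfolding costate_left_def using t ob by (simp add: category_simps monoidal_simps(8-) del: runit_inv_props(5))
  also have "\<dots> = k" using t ob by (simp add: monoidal_simps)
  finally show ?thesis .
qed


section \<open>Selection relations and the Nash product\<close>

lemma mem_sel_map:
  assumes "f \<in> hom M X Y"
  shows "(s, k) \<in> sel_map M f \<epsilon>
    \<longleftrightarrow> k \<in> hom M Y \<I> \<and> (\<exists>x \<in> hom M \<I> X. s = x \<Zsemi> f \<and> (x, f \<Zsemi> k) \<in> \<epsilon>)"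
  using homD[OF assms] unfolding sel_map_def by auto

lemma mem_nash_product:
  "(s, k) \<in> nash_product M X Y \<epsilon> \<delta>
    \<longleftrightarrow> k \<in> hom M (X \<otimes>\<^sub>o Y) \<I> \<and> (\<exists>x \<in> hom M \<I> X. \<exists>y \<in> hom M \<I> Y. s = tensor_state M x y
      \<and> (x, costate_left M X y k) \<in> \<epsilon> \<and> (y, costate_right M Y x k) \<in> \<delta>)"
  unfolding nash_product_def by auto

text \<open>The common shape of the composites \<open>\<boxtimes> \<Zsemi> \<S>(h)\<close> in all laws, with \<open>h\<close> a tensor of
  arrows, an associator or a unitor: a costate \<open>k\<close> of the target is judged through \<open>h \<Zsemi> k\<close>.\<close>

lemma mem_sel_map_nash_product:
  assumes h: "h \<in> hom M (X \<otimes>\<^sub>o Y) W"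
  shows "(s, k) \<in> sel_map M h (nash_product M X Y \<epsilon> \<delta>)
    \<longleftrightarrow> k \<in> hom M W \<I> \<and> (\<exists>x \<in> hom M \<I> X. \<exists>y \<in> hom M \<I> Y. s = tensor_state M x y \<Zsemi> h
      \<and> (x, costate_left M X y (h \<Zsemi> k)) \<in> \<epsilon> \<and> (y, costate_right M Y x (h \<Zsemi> k)) \<in> \<delta>)"
  unfolding mem_sel_map[OF h] mem_nash_product
  using seq_closed[OF h] tensor_state_closed by blast

lemma sel_rels_typed:
  "\<epsilon> \<in> sel_rels M X \<Longrightarrow> (x, k) \<in> \<epsilon> \<Longrightarrow> x \<in> hom M \<I> X \<and> k \<in> hom M X \<I>"
  unfolding sel_rels_def by auto

lemma sel_map_closed:
  assumes f: "f \<in> hom M X Y"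
  shows "sel_map M f \<epsilon> \<in> sel_rels M Y"
  unfolding sel_rels_def using seq_closed[OF _ f] by (auto simp: mem_sel_map[OF f])

lemma sel_map_mono: "\<epsilon> \<subseteq> \<epsilon>' \<Longrightarrow> sel_map M f \<epsilon> \<subseteq> sel_map M f \<epsilon>'"
  unfolding sel_map_def by blast

lemma sel_map_ident:
  assumes X: "X \<in> Ob M" and \<epsilon>: "\<epsilon> \<in> sel_rels M X"
  shows "sel_map M (ident M X) \<epsilon> = \<epsilon>"
proof (intro set_eqI, clarify)
  fix s k
  show "(s, k) \<in> sel_map M (ident M X) \<epsilon> \<longleftrightarrow> (s, k) \<in> \<epsilon>"
    unfolding mem_sel_map[OF ident_closed[OF X]]
    using sel_rels_typed[OF \<epsilon>] by (metis ident_seq seq_ident)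
qed

lemma sel_map_seq:
  assumes f: "f \<in> hom M X Y" and g: "g \<in> hom M Y Z"
  shows "sel_map M (f \<Zsemi> g) \<epsilon> = sel_map M g (sel_map M f \<epsilon>)"
proof (intro set_eqI, clarify)
  fix s k
  show "(s, k) \<in> sel_map M (f \<Zsemi> g) \<epsilon> \<longleftrightarrow> (s, k) \<in> sel_map M g (sel_map M f \<epsilon>)"
    unfolding mem_sel_map[OF seq_closed[OF f g]] mem_sel_map[OF f] mem_sel_map[OF g]
    using seq_assoc[OF _ f g] seq_assoc[OF f g] seq_closed[OF _ f] seq_closed[OF g] by metis
qed

lemma nash_product_closed: "nash_product M X Y \<epsilon> \<delta> \<in> sel_rels M (X \<otimes>\<^sub>o Y)"
  unfolding sel_rels_def using tensor_state_closed by (auto simp: mem_nash_product)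

lemma nash_product_mono:
  "\<epsilon> \<subseteq> \<epsilon>' \<Longrightarrow> \<delta> \<subseteq> \<delta>' \<Longrightarrow> nash_product M X Y \<epsilon> \<delta> \<subseteq> nash_product M X Y \<epsilon>' \<delta>'"
  unfolding nash_product_def by blast

lemma nash_product_natural:
  assumes f: "f \<in> hom M X X'" and g: "g \<in> hom M Y Y'"
  shows "nash_product M X' Y' (sel_map M f \<epsilon>) (sel_map M g \<delta>)
    = sel_map M (f \<otimes> g) (nash_product M X Y \<epsilon> \<delta>)"
proof (intro set_eqI, clarify)
  fix s k
  have ob: "X' \<in> Ob M" "Y' \<in> Ob M" using homD[OF f] homD[OF g] tgt_closed by auto
  note fg = tensor_ar_closed[OF f g]
  let ?P = "\<lambda>x y. s = tensor_state M (x \<Zsemi> f) (y \<Zsemi> g)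
    \<and> (x, f \<Zsemi> costate_left M X' (y \<Zsemi> g) k) \<in> \<epsilon> \<and> (y, g \<Zsemi> costate_right M Y' (x \<Zsemi> f) k) \<in> \<delta>"
  have "(s, k) \<in> nash_product M X' Y' (sel_map M f \<epsilon>) (sel_map M g \<delta>)
      \<longleftrightarrow> k \<in> hom M (X' \<otimes>\<^sub>o Y') \<I> \<and> (\<exists>x \<in> hom M \<I> X. \<exists>y \<in> hom M \<I> Y. ?P x y)"
    unfolding mem_nash_product mem_sel_map[OF f] mem_sel_map[OF g]
    using costate_left_closed[OF ob(1)] costate_right_closed[OF ob(2)] seq_closed[OF _ f] seq_closed[OF _ g]
    by blast
  also have "\<dots> \<longleftrightarrow> (s, k) \<in> sel_map M (f \<otimes> g) (nash_product M X Y \<epsilon> \<delta>)"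
    unfolding mem_sel_map_nash_product[OF fg]
    by (simp add: tensor_state_natural[OF _ _ f g] costate_left_natural[OF _ f g]
        costate_right_natural[OF _ f g] cong: bex_cong conj_cong)
  finally show "(s, k) \<in> nash_product M X' Y' (sel_map M f \<epsilon>) (sel_map M g \<delta>)
      \<longleftrightarrow> (s, k) \<in> sel_map M (f \<otimes> g) (nash_product M X Y \<epsilon> \<delta>)" .
qed

text \<open>Membership on either side unfolds to the existence of three states with one
  condition per player. For fixed states, the two sets of conditions agree by the equations for
  partial evaluations.\<close>

lemma nash_product_assoc:
  assumes ob: "X \<in> Ob M" "Y \<in> Ob M" "Z \<in> Ob M"
  shows "sel_map M (assoc M X Y Z) (nash_product M (X \<otimes>\<^sub>o Y) Z (nash_product M X Y \<epsilon> \<delta>) \<gamma>)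
    = nash_product M X (Y \<otimes>\<^sub>o Z) \<epsilon> (nash_product M Y Z \<delta> \<gamma>)"
proof (intro set_eqI, clarify)
  fix s k
  note \<alpha> = assoc_closed[OF ob]
  have ob2: "X \<otimes>\<^sub>o Y \<in> Ob M" "Y \<otimes>\<^sub>o Z \<in> Ob M" using ob tensor_ob_closed by auto
  let ?A = "\<lambda>x y z. x \<in> hom M \<I> X \<and> y \<in> hom M \<I> Y \<and> z \<in> hom M \<I> Z"
  let ?k = "assoc M X Y Z \<Zsemi> k"
  let ?P = "\<lambda>x y z. s = tensor_state M (tensor_state M x y) z \<Zsemi> assoc M X Y Z
    \<and> (x, costate_left M X y (costate_left M (X \<otimes>\<^sub>o Y) z ?k)) \<in> \<epsilon>
    \<and> (y, costate_right M Y x (costate_left M (X \<otimes>\<^sub>o Y) z ?k)) \<in> \<delta>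
    \<and> (z, costate_right M Z (tensor_state M x y) ?k) \<in> \<gamma>"
  let ?Q = "\<lambda>x y z. s = tensor_state M x (tensor_state M y z)
    \<and> (x, costate_left M X (tensor_state M y z) k) \<in> \<epsilon>
    \<and> (y, costate_left M Y z (costate_right M (Y \<otimes>\<^sub>o Z) x k)) \<in> \<delta>
    \<and> (z, costate_right M Z y (costate_right M (Y \<otimes>\<^sub>o Z) x k)) \<in> \<gamma>"
  have "(s, k) \<in> sel_map M (assoc M X Y Z) (nash_product M (X \<otimes>\<^sub>o Y) Z (nash_product M X Y \<epsilon> \<delta>) \<gamma>)
      \<longleftrightarrow> k \<in> hom M (X \<otimes>\<^sub>o (Y \<otimes>\<^sub>o Z)) \<I> \<and> (\<exists>x y z. ?A x y z \<and> ?P x y z)"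
  proof (cases "k \<in> hom M (X \<otimes>\<^sub>o (Y \<otimes>\<^sub>o Z)) \<I>")
    case True
    have k': "?k \<in> hom M ((X \<otimes>\<^sub>o Y) \<otimes>\<^sub>o Z) \<I>"
      using True by (rule seq_closed[OF \<alpha>])
    have "costate_left M (X \<otimes>\<^sub>o Y) z ?k \<in> hom M (X \<otimes>\<^sub>o Y) \<I>" if "z \<in> hom M \<I> Z" for z
      using that k' by (rule costate_left_closed[OF ob2(1)])
    with True k' show ?thesis
      unfolding mem_sel_map_nash_product[OF \<alpha>] mem_nash_product
      using tensor_state_closed[of _ X _ Y] by auto
  qed (simp add: mem_sel_map[OF \<alpha>])
  also have "\<dots> \<longleftrightarrow> k \<in> hom M (X \<otimes>\<^sub>o (Y \<otimes>\<^sub>o Z)) \<I> \<and> (\<exists>x y z. ?A x y z \<and> ?Q x y z)"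
    using tensor_state_assoc[OF ob] costate_left_left[OF ob] costate_right_left[OF ob]
      costate_right_right[OF ob]
    by (intro conj_cong refl ex_cong1) auto
  also have "\<dots> \<longleftrightarrow> (s, k) \<in> nash_product M X (Y \<otimes>\<^sub>o Z) \<epsilon> (nash_product M Y Z \<delta> \<gamma>)"
  proof (cases "k \<in> hom M (X \<otimes>\<^sub>o (Y \<otimes>\<^sub>o Z)) \<I>")
    case True
    have "costate_right M (Y \<otimes>\<^sub>o Z) x k \<in> hom M (Y \<otimes>\<^sub>o Z) \<I>" if "x \<in> hom M \<I> X" for x
      using that True by (rule costate_right_closed[OF ob2(2)])
    with True show ?thesis
      unfolding mem_nash_product using tensor_state_closed[of _ Y _ Z] by blast
  qed (simp add: mem_nash_product)
  finally show "(s, k) \<in> sel_map M (assoc M X Y Z) (nash_product M (X \<otimes>\<^sub>o Y) Z (nash_product M X Y \<epsilon> \<delta>) \<gamma>)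
      \<longleftrightarrow> (s, k) \<in> nash_product M X (Y \<otimes>\<^sub>o Z) \<epsilon> (nash_product M Y Z \<delta> \<gamma>)" .
qed

text \<open>The relation must relate the identity to every costate: in \<open>sel_unit \<boxtimes> \<delta>\<close> the costate that the
  trivial player faces can be any arrow \<open>\<I> \<rightarrow> \<I>\<close>, and excluding one would
  lose elements of some \<open>\<delta>\<close>, already on \<open>\<I>\<close>.\<close>

definition sel_unit :: "('a \<times> 'a) set" where
  "sel_unit = {ident M \<I>} \<times> hom M \<I> \<I>"

lemma sel_unit_closed: "sel_unit \<in> sel_rels M \<I>"
  unfolding sel_unit_def sel_rels_def using ident_closed[OF unit_closed] by auto

lemma nash_product_sel_unit_left:
  assumes X: "X \<in> Ob M" and \<delta>: "\<delta> \<in> sel_rels M X"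
  shows "sel_map M (lunit M X) (nash_product M \<I> X sel_unit \<delta>) = \<delta>"
proof (intro set_eqI, clarify)
  fix s k
  note i = ident_closed[OF unit_closed] and l = lunit_closed[OF X]
  show "(s, k) \<in> sel_map M (lunit M X) (nash_product M \<I> X sel_unit \<delta>) \<longleftrightarrow> (s, k) \<in> \<delta>" (is "?L \<longleftrightarrow> ?R")
  proof
    assume ?L
    then obtain y where y: "y \<in> hom M \<I> X" and k: "k \<in> hom M X \<I>"
      and s: "s = tensor_state M (ident M \<I>) y \<Zsemi> lunit M X"
      and m: "(y, costate_right M X (ident M \<I>) (lunit M X \<Zsemi> k)) \<in> \<delta>"
      unfolding mem_sel_map_nash_product[OF l] sel_unit_def by auto
    show ?R using s m tensor_state_ident_left[OF y] costate_right_ident[OF k] by simp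
  next
    assume m: ?R
    then have s: "s \<in> hom M \<I> X" and k: "k \<in> hom M X \<I>" using sel_rels_typed[OF \<delta>] by auto
    have "costate_left M \<I> s (lunit M X \<Zsemi> k) \<in> hom M \<I> \<I>"
      by (rule costate_left_closed[OF unit_closed s seq_closed[OF l k]])
    with m k s i show ?L
      unfolding mem_sel_map_nash_product[OF l] sel_unit_def
      by (intro conjI bexI[of _ "ident M \<I>"] bexI[of _ s])
        (simp_all add: tensor_state_ident_left costate_right_ident)
  qed
qed

lemma nash_product_sel_unit_right:
  assumes X: "X \<in> Ob M" and \<epsilon>: "\<epsilon> \<in> sel_rels M X"
  shows "sel_map M (runit M X) (nash_product M X \<I> \<epsilon> sel_unit) = \<epsilon>"
proof (intro set_eqI, clarify)
  fix s k
  note i = ident_closed[OF unit_closed] and r = runit_closed[OF X]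
  show "(s, k) \<in> sel_map M (runit M X) (nash_product M X \<I> \<epsilon> sel_unit) \<longleftrightarrow> (s, k) \<in> \<epsilon>" (is "?L \<longleftrightarrow> ?R")
  proof
    assume ?L
    then obtain x where x: "x \<in> hom M \<I> X" and k: "k \<in> hom M X \<I>"
      and s: "s = tensor_state M x (ident M \<I>) \<Zsemi> runit M X"
      and m: "(x, costate_left M X (ident M \<I>) (runit M X \<Zsemi> k)) \<in> \<epsilon>"
      unfolding mem_sel_map_nash_product[OF r] sel_unit_def by auto
    show ?R using s m tensor_state_ident_right[OF x] costate_left_ident[OF k] by simp
  next
    assume m: ?R
    then have s: "s \<in> hom M \<I> X" and k: "k \<in> hom M X \<I>" using sel_rels_typed[OF \<epsilon>] by auto
    have "costate_right M \<I> s (runit M X \<Zsemi> k) \<in> hom M \<I> \<I>"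
      by (rule costate_right_closed[OF unit_closed s seq_closed[OF r k]])
    with m k s i show ?L
      unfolding mem_sel_map_nash_product[OF r] sel_unit_def
      by (intro conjI bexI[of _ s] bexI[of _ "ident M \<I>"])
        (simp_all add: tensor_state_ident_right costate_left_ident)
  qed
qed

end

section \<open>The lax monoidal functor\<close>

lemma poset_category: "category (poset_cat P)"
  by unfold_locales (auto simp: poset_cat_def hom_def)

lemma prod_category:
  assumes "category C" "category D"
  shows "category (C \<times>\<^sub>C D)"
proof -
  interpret C: category C by fact
  interpret D: category D by fact
  show ?thesis
    by unfold_locales (auto simp: prod_cat_def hom_def C.category_simps D.category_simps)
qed

lemma terminal_category: "category terminal_cat"
  by unfold_locales (auto simp: terminal_cat_def hom_def)

lemma mono_functor:
  assumes "\<And>p. p \<in> P \<Longrightarrow> h p \<in> Q" "\<And>p p'. p \<le> p' \<Longrightarrow> h p \<le> h p'"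
  shows "functor_between (poset_cat P) (poset_cat Q) (mono_fctr h)"
  unfolding functor_between_def
  by (intro conjI poset_category) (auto simp: poset_cat_def mono_fctr_def hom_def intro: assms)

lemma mono_functor2:
  assumes "\<And>p q. p \<in> P \<Longrightarrow> q \<in> Q \<Longrightarrow> h p q \<in> R"
    "\<And>p p' q q'. p \<le> p' \<Longrightarrow> q \<le> q' \<Longrightarrow> h p q \<le> h p' q'"
  shows "functor_between (poset_cat P \<times>\<^sub>C poset_cat Q) (poset_cat R) (mono_fctr2 h)"
  unfolding functor_between_def
  by (intro conjI poset_category prod_category)
    (auto simp: poset_cat_def prod_cat_def mono_fctr2_def hom_def intro: assms)

theorem proposition14:
  fixes M :: "('o, 'a, 'm) monoidal_cat_scheme"
  assumes "monoidal_category M"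
  shows "\<exists>\<eta>. lax_monoidal_functor_to_Cat M (sel_ob M) (sel_ar M) (nash_laxator M) \<eta>"
proof -
  interpret monoidal_category M by fact
  let ?\<eta> = "\<lparr>on_ob = \<lambda>_. sel_unit, on_ar = \<lambda>_. (sel_unit, sel_unit)\<rparr>"
  note fctr_defs = functor_eq_def sel_ob_def sel_ar_def poset_cat_def prod_cat_def terminal_cat_def
    mono_fctr_def mono_fctr2_def seq_fctr_def prod_fctr_def id_fctr_def nash_laxator_def
    assoc_Cat_def lunit_Cat_def runit_Cat_def
  have "Cat_valued_functor_axioms M (sel_ob M) (sel_ar M)"
  proof (rule Cat_valued_functor_axioms.intro)
    fix X Y Z f g
    show "category (sel_ob M X)"
      unfolding sel_ob_def by (rule poset_category)
    show "functor_eq (sel_ob M X) (sel_ar M (ident M X)) id_fctr" if "X \<in> Ob M"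
      using that by (auto simp: fctr_defs sel_map_ident)
    assume f: "f \<in> hom M X Y"
    then show "functor_between (sel_ob M X) (sel_ob M Y) (sel_ar M f)"
      unfolding sel_ob_def sel_ar_def by (intro mono_functor sel_map_closed sel_map_mono)
    assume "g \<in> hom M Y Z"
    with f show "functor_eq (sel_ob M X) (sel_ar M (f \<Zsemi>\<^bsub>M\<^esub> g)) (sel_ar M f ;; sel_ar M g)"
      by (auto simp: fctr_defs sel_map_seq)
  qed
  moreover have "lax_monoidal_functor_to_Cat_axioms M (sel_ob M) (sel_ar M) (nash_laxator M) ?\<eta>"
  proof (rule lax_monoidal_functor_to_Cat_axioms.intro, goal_cases)
    case (1 X Y)
    show ?case unfolding sel_ob_def nash_laxator_def
      by (intro mono_functor2 nash_product_closed nash_product_mono)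
  next
    case 2
    show ?case unfolding functor_between_def sel_ob_def
      by (intro conjI terminal_category poset_category)
        (auto simp: poset_cat_def terminal_cat_def hom_def sel_unit_closed)
  next
    case (3 f X X' g Y Y')
    then show ?case by (auto simp: fctr_defs nash_product_natural)
  next
    case (4 X Y Z)
    then show ?case by (auto simp: fctr_defs nash_product_assoc)
  next
    case (5 X)
    then show ?case by (auto simp: fctr_defs nash_product_sel_unit_left)
  next
    case (6 X)
    then show ?case by (auto simp: fctr_defs nash_product_sel_unit_right)
  qed
  ultimately have "lax_monoidal_functor_to_Cat M (sel_ob M) (sel_ar M) (nash_laxator M) ?\<eta>"
    by (intro lax_monoidal_functor_to_Cat.intro Cat_valued_functor.intro monoidal_category_axioms
        category_axioms)
  then show ?thesis by blast
qed

end
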